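(* Let $n\ge 5$ be an integer and let $F_n=2^{2^n}+1$. Then $F_n$ is pseudoprime to the base $3$ if and only if $$3^{(F_n-1)/2}\equiv 1 \pmod{F_n}.$$
   Context: For an integer $n\ge 0$, $F_n=2^{2^n}+1$ denotes the $n$th Fermat number. An integer $N>1$ is called pseudoprime to the base $a$ (Fermat pseudoprime) if $N$ is composite and $a^{N-1}\equiv 1 \pmod N$. *)

theory Defs
  imports "HOL-Number_Theory.Number_Theory"
begin

definition fermat :: "nat \<Rightarrow> nat" where
  "fermat n = 2 ^ (2 ^ n) + 1"

definition fermat_pseudoprime :: "int \<Rightarrow> nat \<Rightarrow> bool" where
  "fermat_pseudoprime a N \<longleftrightarrow> N > 1 \<and> \<not> prime N \<and> [a ^ (N - 1) = 1] (mod int N)"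

end

theory Submission
  imports Defs
begin

text \<open>
  Since \<open>F\<^sub>n - 1\<close> is a power of \<open>2\<close>, Lucas's criterion shows that \<open>F\<^sub>n\<close> is prime as soon as
  \<open>3\<^bsup>F\<^sub>n - 1\<^esup> \<equiv> 1\<close> but \<open>3\<^bsup>(F\<^sub>n - 1)/2\<^esup> \<notequiv> 1\<close> modulo \<open>F\<^sub>n\<close>. Conversely, if \<open>F\<^sub>n\<close> is
  prime, then quadratic reciprocity and \<open>F\<^sub>n \<equiv> 2 (mod 3)\<close> show that \<open>3\<close> is a non-residue,
  so \<open>3\<^bsup>(F\<^sub>n - 1)/2\<^esup> \<equiv> -1 \<notequiv> 1\<close> (Pepin).
\<close>

text \<open>The only prime that can divide \<open>2 ^ k\<close> is 2, so Lucas's criterion has a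
  single exponent to test.\<close>

lemma lucas_two_power:
  fixes a k :: nat
  assumes "[a ^ (2 ^ k) = 1] (mod (2 ^ k + 1))"
    and "[a ^ (2 ^ k div 2) \<noteq> 1] (mod (2 ^ k + 1))"
  shows "prime (2 ^ k + 1 :: nat)"
proof (rule lucas)
  show "\<forall>p. prime p \<and> p dvd 2 ^ k + 1 - 1 \<longrightarrow>
          [a ^ ((2 ^ k + 1 - 1) div p) \<noteq> 1] (mod (2 ^ k + 1))"
  proof (intro allI impI, elim conjE)
    fix p :: nat
    assume "prime p" "p dvd 2 ^ k + 1 - 1"
    then have "p = 2"
      by (auto dest: prime_dvd_power intro: primes_dvd_imp_eq)
    then show "[a ^ ((2 ^ k + 1 - 1) div p) \<noteq> 1] (mod (2 ^ k + 1))"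
      using assms(2) by simp
  qed
qed (use assms(1) in auto)

text \<open>For positive \<open>n\<close>, \<open>2 ^ 2 ^ n\<close> is a power of 4, and 4 is 1
  modulo 3.\<close>

lemma fermat_mod_3:
  assumes "n \<ge> 1"
  shows "[int (fermat n) = 2] (mod 3)"
proof -
  obtain m where n: "n = Suc m"
    using assms by (cases n) auto
  have "[(4::int) ^ 2 ^ m = 1 ^ 2 ^ m] (mod 3)"
    by (intro cong_pow) (simp add: cong_def)
  then have "[(4::int) ^ 2 ^ m + 1 = 1 + 1] (mod 3)"
    by (intro cong_add) auto
  then show ?thesis
    by (simp add: fermat_def n power_mult add.commute)
qed

text \<open>Squares modulo 3 are 0 or 1; \<open>QuadRes\<close> admits the zero class, so only 2 is
  excluded.\<close>

lemma QuadRes_3_iff: "QuadRes 3 a \<longleftrightarrow> [a \<noteq> 2] (mod 3)"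
proof -
  have squares: "y\<^sup>2 mod 3 = 0 \<or> y\<^sup>2 mod 3 = 1" for y :: int
  proof -
    have "y mod 3 = 0 \<or> y mod 3 = 1 \<or> y mod 3 = 2" by presburger
    then show ?thesis by (auto simp flip: power_mod[of y])
  qed
  have "a mod 3 = 0 \<or> a mod 3 = 1 \<or> a mod 3 = 2" by presburger
  then show ?thesis
  proof (elim disjE)
    assume "a mod 3 = 0"
    then show ?thesis by (auto simp: QuadRes_def cong_def intro: exI[of _ 0])
  next
    assume "a mod 3 = 1"
    then show ?thesis by (auto simp: QuadRes_def cong_def intro: exI[of _ 1])
  next
    assume a: "a mod 3 = 2"
    then have "\<not> QuadRes 3 a"
      unfolding QuadRes_def cong_def
    proof (intro notI, elim exE)
      fix y :: int
      assume "y\<^sup>2 mod 3 = a mod 3"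
      with squares[of y] a show False by linarith
    qed
    with a show ?thesis by (simp add: cong_def)
  qed
qed

lemma Legendre_3_fermat_prime:
  assumes "prime (fermat n)" "n \<ge> 1"
  shows "Legendre 3 (int (fermat n)) = -1"
proof -
  \<comment> \<open>Splitting off the factor 4 makes half of \<open>fermat n - 1\<close> even, so
    the sign in the reciprocity law is +1.\<close>
  obtain m where m: "(2::nat) ^ n = m + 2"
    using assms(2) by (metis add.commute le_Suc_ex one_le_numeral power_increasing power_one_right)
  have F: "fermat n = 4 * 2 ^ m + 1"
    by (simp add: fermat_def m)
  have "even ((fermat n - 1) div 2)"
    by (simp add: F)
  moreover have "fermat n > 3"
    using one_le_power[of "2::nat" m] unfolding F by linarith
  ultimately have "Legendre 3 (int (fermat n)) * Legendre (int (fermat n)) 3 = 1"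
    using Quadratic_Reciprocity[of 3 "fermat n"] assms(1) by simp
  moreover have "Legendre (int (fermat n)) 3 = -1"
    using fermat_mod_3[OF assms(2)] QuadRes_3_iff[of "int (fermat n)"]
    by (simp add: Legendre_def cong_def)
  ultimately show ?thesis by simp
qed

lemma fermat_gt_2:
  assumes "n \<ge> 1"
  shows "fermat n > 2"
proof -
  have "(2::nat) ^ 1 \<le> 2 ^ (2 ^ n)"
    by (rule power_increasing) auto
  then show ?thesis by (simp add: fermat_def)
qed

lemma pepin_necessary:
  assumes "prime (fermat n)" "n \<ge> 1"
  shows "[(3::int) ^ ((fermat n - 1) div 2) = -1] (mod int (fermat n))"
  using euler_criterion[OF assms(1) fermat_gt_2[OF assms(2)], of 3]
    Legendre_3_fermat_prime[OF assms] cong_sym by simp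

theorem theorem2:
  fixes n :: nat
  assumes "n \<ge> 5"
  shows "fermat_pseudoprime 3 (fermat n) \<longleftrightarrow>
    [(3::int) ^ ((fermat n - 1) div 2) = 1] (mod int (fermat n))"
proof
  assume *: "fermat_pseudoprime 3 (fermat n)"
  have "[(3::nat) ^ (2 ^ 2 ^ n) = 1] (mod (2 ^ 2 ^ n + 1))"
    using * by (simp add: fermat_pseudoprime_def fermat_def flip: cong_int_iff)
  \<comment> \<open>Otherwise the Lucas criterion would make the composite number
    \<open>fermat n\<close> prime.\<close>
  then have "[(3::nat) ^ (2 ^ 2 ^ n div 2) = 1] (mod (2 ^ 2 ^ n + 1))"
    using lucas_two_power[of 3 "2 ^ n"] * by (auto simp: fermat_pseudoprime_def fermat_def)
  then show "[(3::int) ^ ((fermat n - 1) div 2) = 1] (mod int (fermat n))"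
    by (simp add: fermat_def flip: cong_int_iff)
next
  assume *: "[(3::int) ^ ((fermat n - 1) div 2) = 1] (mod int (fermat n))"
  have n: "n \<ge> 1" and gt: "fermat n > 2"
    using assms fermat_gt_2[of n] by auto
  have "\<not> prime (fermat n)"
  proof
    assume "prime (fermat n)"
    \<comment> \<open>The half power would be both -1 and 1, forcing \<open>fermat n\<close> to
      divide 2.\<close>
    from pepin_necessary[OF this n] * have "[- 1 = 1] (mod int (fermat n))"
      by (metis cong_sym cong_trans)
    then have "int (fermat n) dvd 2"
      by (simp add: cong_iff_dvd_diff)
    with gt show False
      by (auto dest: zdvd_imp_le)
  qed
  moreover have "[(3::int) ^ (fermat n - 1) = 1] (mod int (fermat n))"
  proof -
    \<comment> \<open>Evenness makes the division by 2 exact, so squaring the half power recovers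
      the full one.\<close>
    have "even (fermat n - 1)"
      by (simp add: fermat_def)
    then have "(3::int) ^ (fermat n - 1) = (3 ^ ((fermat n - 1) div 2)) ^ 2"
      by (simp flip: power_mult)
    then show ?thesis
      using cong_pow[OF *, of 2] by simp
  qed
  ultimately show "fermat_pseudoprime 3 (fermat n)"
    using gt by (simp add: fermat_pseudoprime_def)
qed

end
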